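(* Let $p$ be a prime, let $q=p^h$ with $h\geq 1$, and let $k$ be a positive integer. Let $S$ be a set of vectors of ${\mathbb F}_q^k$ with the property that every subset of $S$ of size $k$ is a basis of ${\mathbb F}_q^k$. If $k \leq p$ then $|S| \leq q+1$.
   Context: ${\mathbb F}_q$ denotes the finite field with $q$ elements. *)

theory Defs
  imports
    "HOL-Library.Cardinality"
    "HOL-Computational_Algebra.Primes"
    "Jordan_Normal_Form.VS_Connect"
begin

end

theory Submission
  imports Defs "HOL-Number_Theory.Residues"
begin

text \<open>Identify \<open>c \<in> F\<^sup>k\<close> with the function \<open>x \<mapsto> c \<bullet> x\<close> on \<open>S\<close>: the hypothesis says that these functions
  form a \<open>k\<close>-dimensional MDS code of length \<open>n = |S|\<close>. Suppose \<open>n = q + 2\<close> and put \<open>r = k - 2\<close>. Passing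
  to the dual code, we may assume that some \<open>E \<subseteq> S\<close> has \<open>2r + 1\<close> elements. For an \<open>r\<close>-subset \<open>Y\<close> of
  \<open>E\<close>, the codewords vanishing on \<open>Y\<close> form a plane; let \<open>d\<^sub>Y(a, b)\<close> be the \<open>2 \<times> 2\<close> determinant of the
  evaluations at \<open>a\<close> and \<open>b\<close> on it, and
  \<open>g\<^sub>Y(a) = 1 / ((\<Prod>u\<in>S - Y - {a}. d\<^sub>Y(a, u)) (\<Prod>z\<in>E - Y - {a}. d\<^sub>Y(a, z)))\<close>.
  Up to a factor depending only on \<open>Y\<close>, the reciprocal of the first product is the tangent function
  of Segre and Ball.
  Lagrange interpolation and Wilson's theorem give \<open>\<Sum>\<^sub>a g\<^sub>Y(a) = 0\<close>, summing over \<open>a \<in> E - Y\<close>; Segre's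
  lemma of tangents is a cocycle condition on \<open>g\<close>, so after rescaling by a factor depending on \<open>Y\<close>, \<open>g\<^sub>Y(a)\<close>
  depends only on \<open>Y \<union> {a}\<close>. This yields a nowhere zero vector in the kernel of the inclusion
  matrix of \<open>r\<close>-subsets against \<open>(r + 1)\<close>-subsets of \<open>E\<close>, which is invertible in characteristic
  \<open>p > r + 1\<close>, a contradiction.\<close>

subsection \<open>Inclusion matrices and cocycles on Johnson graphs\<close>

text \<open>Double counting, by induction downwards from \<open>card S = r\<close>, where
  \<open>local\<close> is the claim itself. Adding up the vanishing sums for all
  \<open>insert a S\<close> counts each \<open>C\<close> once for every element of
  \<open>C - S\<close>; this number \<open>Suc r - card S\<close> is invertible by
  \<open>char\<close>.\<close>

lemma sum_containing_sets_eq_0: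
  fixes v :: "'i set \<Rightarrow> 'f :: field"
  assumes fin: "finite E"
    and local: "\<And>Y. Y \<subseteq> E \<Longrightarrow> card Y = r \<Longrightarrow> (\<Sum>a\<in>E - Y. v (insert a Y)) = 0"
    and char: "\<And>j. 0 < j \<Longrightarrow> j \<le> Suc r \<Longrightarrow> of_nat j \<noteq> (0 :: 'f)"
    and S: "S \<subseteq> E" "card S \<le> r"
  shows "(\<Sum>C | C \<subseteq> E \<and> card C = Suc r \<and> S \<subseteq> C. v C) = 0"
proof -
  have finS: "finite X" if "X \<subseteq> E" for X
    using fin that by (rule rev_finite_subset)
  show ?thesis
    using S(2,1)
  proof (induction "r - card S" arbitrary: S)
    case 0
    then have base: "S \<subseteq> E" "card S = r" by auto
    then have "finite S" using finS by blast
    have "{C. C \<subseteq> E \<and> card C = Suc r \<and> S \<subseteq> C} = (\<lambda>a. insert a S) ` (E - S)"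
    proof (intro equalityI subsetI)
      fix C assume "C \<in> {C. C \<subseteq> E \<and> card C = Suc r \<and> S \<subseteq> C}"
      then have C: "C \<subseteq> E" "card C = Suc r" "S \<subseteq> C" by auto
      then have "card (C - S) = 1"
        using base \<open>finite S\<close> by (simp add: card_Diff_subset)
      then obtain a where a: "C - S = {a}" by (rule card_1_singletonE)
      then have "C = insert a S" "a \<in> E - S" using C by auto
      then show "C \<in> (\<lambda>a. insert a S) ` (E - S)" by blast
    qed (use base \<open>finite S\<close> in auto)
    moreover have "inj_on (\<lambda>a. insert a S) (E - S)"
      by (auto simp: inj_on_def)
    ultimately show ?case
      using local[of S] base by (simp add: sum.reindex)
  next
    case (Suc n)
    note step = Suc
    let ?F = "{C. C \<subseteq> E \<and> card C = Suc r \<and> S \<subseteq> C}"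
    have finF: "finite ?F" using fin by simp
    have "finite S" using step finS by blast
    have "0 = (\<Sum>a\<in>E - S. \<Sum>C | C \<subseteq> E \<and> card C = Suc r \<and> insert a S \<subseteq> C. v C)"
      using step \<open>finite S\<close> by (intro sum.neutral[symmetric] ballI step(1)) auto
    also have "\<dots> = (\<Sum>a\<in>E - S. \<Sum>C | C \<in> ?F \<and> a \<in> C. v C)"
      by (intro sum.cong) auto
    also have "\<dots> = (\<Sum>C\<in>?F. \<Sum>a | a \<in> E - S \<and> a \<in> C. v C)"
      using fin finF by (subst sum.swap_restrict) auto
    also have "\<dots> = (\<Sum>C\<in>?F. of_nat (Suc r - card S) * v C)"
    proof (intro sum.cong refl)
      fix C assume C: "C \<in> ?F"
      then have "{a. a \<in> E - S \<and> a \<in> C} = C - S" by auto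
      then show "(\<Sum>a | a \<in> E - S \<and> a \<in> C. v C) = of_nat (Suc r - card S) * v C"
        using C \<open>finite S\<close> by (simp add: card_Diff_subset)
    qed
    also have "\<dots> = of_nat (Suc r - card S) * (\<Sum>C\<in>?F. v C)"
      by (simp add: sum_distrib_left)
    finally show ?case
      using char[of "Suc r - card S"] step by simp
  qed
qed

text \<open>Inclusion-exclusion extends the vanishing to sums over the \<open>C\<close> that contain
  \<open>S\<close> and avoid \<open>T\<close>, as long as \<open>card S + card T \<le> r\<close>.
  Since \<open>card E = 2 * r + 1\<close>, the complement of \<open>C\<close> has \<open>r\<close>
  elements and \<open>C\<close> is the only set of size \<open>Suc r\<close> avoiding it, so that
  sum is the single entry \<open>v C\<close>.\<close>

lemma inclusion_matrix_kernel_trivial: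
  fixes v :: "'i set \<Rightarrow> 'f :: field"
  assumes fin: "finite E" and E: "card E = 2 * r + 1"
    and local: "\<And>Y. Y \<subseteq> E \<Longrightarrow> card Y = r \<Longrightarrow> (\<Sum>a\<in>E - Y. v (insert a Y)) = 0"
    and char: "\<And>j. 0 < j \<Longrightarrow> j \<le> Suc r \<Longrightarrow> of_nat j \<noteq> (0 :: 'f)"
    and C: "C \<subseteq> E" "card C = Suc r"
  shows "v C = 0"
proof -
  define F where "F S T = {C. C \<subseteq> E \<and> card C = Suc r \<and> S \<subseteq> C \<and> C \<inter> T = {}}" for S T
  have finF: "finite (F S T)" for S T unfolding F_def using fin by simp
  have avoid: "S \<subseteq> E \<Longrightarrow> card S + card T \<le> r \<Longrightarrow> (\<Sum>C\<in>F S T. v C) = 0"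
    if "finite T" for S T
    using that
  proof (induction T arbitrary: S rule: finite_induct)
    case empty
    then show ?case
      using sum_containing_sets_eq_0[OF fin local char, where S = S] by (simp add: F_def)
  next
    case (insert x T)
    have fS: "finite S" using insert fin by (blast intro: finite_subset)
    show ?case
    proof (cases "x \<in> E \<and> x \<notin> S")
      case False
      then have "F S (insert x T) = F S T \<or> F S (insert x T) = {}"
        unfolding F_def by blast
      then show ?thesis using insert by auto
    next
      case True
      \<comment> \<open>Sorting by membership of \<open>x\<close> moves \<open>x\<close> from the
        avoided set to the contained one, so the bound on the cardinalities survives.\<close>
      have split: "F S T = F S (insert x T) \<union> F (insert x S) T"
        unfolding F_def by blast
      have "F S (insert x T) \<inter> F (insert x S) T = {}"
        unfolding F_def by blast
      then have "(\<Sum>C\<in>F S T. v C) = (\<Sum>C\<in>F S (insert x T). v C) + (\<Sum>C\<in>F (insert x S) T. v C)"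
        unfolding split by (intro sum.union_disjoint finF)
      moreover have "(\<Sum>C\<in>F S T. v C) = 0" "(\<Sum>C\<in>F (insert x S) T. v C) = 0"
        using insert True fS by auto
      ultimately show ?thesis by simp
    qed
  qed
  have fC: "finite C" using C fin by (blast intro: finite_subset)
  have "F {} (E - C) = {C}"
  proof (intro equalityI subsetI)
    fix X assume X: "X \<in> F {} (E - C)"
    then have "X \<subseteq> C" unfolding F_def by blast
    then have "X = C" using X C fC by (intro card_subset_eq) (auto simp: F_def)
    then show "X \<in> {C}" by simp
  qed (use C in \<open>auto simp: F_def\<close>)
  moreover have "card (E - C) = r" using C E fC by (simp add: card_Diff_subset)
  ultimately show ?thesis
    using avoid[of "E - C" "{}"] fin by simp
qed

text \<open>Connectedness of the Johnson graph: exchanging an element of \<open>A - B\<close> for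
  one of \<open>B - A\<close> is a step along an edge that brings \<open>A\<close> closer to
  \<open>B\<close>.\<close>

lemma constant_on_subsets_of_card:
  assumes fin: "finite E"
    and adj: "\<And>D x y. D \<subseteq> E \<Longrightarrow> Suc (card D) = r \<Longrightarrow> x \<in> E - D \<Longrightarrow> y \<in> E - D \<Longrightarrow>
                f (insert x D) = f (insert y D)"
    and "A \<subseteq> E" "card A = r" "B \<subseteq> E" "card B = r"
  shows "f A = f B"
  using assms(3-)
proof (induction "card (A - B)" arbitrary: A)
  case 0
  then have fA: "finite A" "finite B" using fin by (auto intro: finite_subset)
  then have "A \<subseteq> B" using 0 by auto
  then have "A = B" using 0 fA by (intro card_subset_eq) auto
  then show ?case by simp
next
  case (Suc n)
  have fA: "finite A" "finite B" using Suc fin by (auto intro: finite_subset)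
  obtain x where x: "x \<in> A - B" using Suc by (metis card.empty ex_in_conv nat.distinct(1))
  have "card (A - B) = card (B - A)"
    using Suc fA by (simp add: card_Diff_subset_Int Int_commute)
  then obtain y where y: "y \<in> B - A" using Suc by (metis card.empty ex_in_conv nat.distinct(1))
  define D where "D = A - {x}"
  have D: "A = insert x D" "x \<notin> D" "y \<notin> D" "x \<noteq> y" "finite D"
    using x y fA by (auto simp: D_def)
  have "insert y D - B = (A - B) - {x}" using x y D by auto
  then have "n = card (insert y D - B)" using Suc(2) x fA by simp
  moreover have "insert y D \<subseteq> E" "card (insert y D) = r" using y D Suc(3,4,5) by auto
  ultimately have "f (insert y D) = f B" using Suc(1,5,6) by blast
  moreover have "f (insert x D) = f (insert y D)"
    using Suc(3,4,5) y D by (intro adj) auto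
  ultimately show ?case using D by simp
qed

lemma cross_cancel:
  fixes a b :: "'f :: field"
  assumes "a * y = b * z" "y * v * t = u * z * s" "z \<noteq> 0"
  shows "a * u * s = b * v * t"
proof -
  have "z * (a * u * s) = a * (u * z * s)" by (simp add: mult_ac)
  also have "\<dots> = a * y * (v * t)" unfolding assms(2)[symmetric] by (simp add: mult_ac)
  also have "\<dots> = z * (b * v * t)" unfolding assms(1) by (simp add: mult_ac)
  finally show ?thesis using assms(3) by simp
qed

text \<open>A multiplicative cocycle on the Johnson graph is a coboundary if it is trivial on the
  triangles \<open>{D \<union> {x}, D \<union> {y}, D \<union> {z}}\<close>.\<close>

lemma cocycle_trivial:
  fixes g :: "'i set \<Rightarrow> 'i \<Rightarrow> 'f :: field"
  assumes "finite E"
    and "\<And>Y a. Y \<subseteq> E \<Longrightarrow> card Y = r \<Longrightarrow> a \<in> E - Y \<Longrightarrow> g Y a \<noteq> 0"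
    and "\<And>D x y z. D \<subseteq> E \<Longrightarrow> Suc (card D) = r \<Longrightarrow> x \<in> E - D \<Longrightarrow> y \<in> E - D \<Longrightarrow> z \<in> E - D \<Longrightarrow>
           x \<noteq> y \<Longrightarrow> y \<noteq> z \<Longrightarrow> x \<noteq> z \<Longrightarrow>
           g (insert x D) y * g (insert y D) z * g (insert z D) x =
           g (insert x D) z * g (insert y D) x * g (insert z D) y"
  shows "\<exists>l. (\<forall>Y. l Y \<noteq> 0) \<and>
    (\<forall>D x y. D \<subseteq> E \<longrightarrow> Suc (card D) = r \<longrightarrow> x \<in> E - D \<longrightarrow> y \<in> E - D \<longrightarrow> x \<noteq> y \<longrightarrow>
       l (insert x D) * g (insert x D) y = l (insert y D) * g (insert y D) x)"
  using assms
proof (induction E arbitrary: r g rule: finite_induct)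
  case empty
  show ?case by (intro exI[of _ "\<lambda>_. 1"]) auto
next
  case (insert w E)
  note nz = insert.prems(1) and tri = insert.prems(2)
  show ?case
  proof (cases r)
    case 0
    then show ?thesis by (intro exI[of _ "\<lambda>_. 1"]) auto
  next
    case (Suc s)
    have fin: "finite D" if "D \<subseteq> E" for D using that insert by (blast intro: finite_subset)
    \<comment> \<open>The induction hypothesis is used twice: here for the \<open>r\<close>-sets
      avoiding \<open>w\<close>, giving \<open>l\<close>, and then for the \<open>r\<close>-sets
      containing \<open>w\<close>, indexed by \<open>s\<close>-subsets of \<open>E\<close>, giving
      \<open>m\<close>.\<close>
    have "\<exists>l. (\<forall>Y. l Y \<noteq> 0) \<and>
      (\<forall>D x y. D \<subseteq> E \<longrightarrow> Suc (card D) = r \<longrightarrow> x \<in> E - D \<longrightarrow> y \<in> E - D \<longrightarrow> x \<noteq> y \<longrightarrow>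
       l (insert x D) * g (insert x D) y = l (insert y D) * g (insert y D) x)"
      by (intro insert.IH nz tri) auto
    then obtain l where l0: "\<And>Y. l Y \<noteq> 0"
      and l: "\<And>D x y. D \<subseteq> E \<Longrightarrow> Suc (card D) = r \<Longrightarrow> x \<in> E - D \<Longrightarrow> y \<in> E - D \<Longrightarrow> x \<noteq> y \<Longrightarrow>
       l (insert x D) * g (insert x D) y = l (insert y D) * g (insert y D) x"
      by blast
    have "\<exists>m. (\<forall>Y. m Y \<noteq> 0) \<and>
      (\<forall>D x y. D \<subseteq> E \<longrightarrow> Suc (card D) = s \<longrightarrow> x \<in> E - D \<longrightarrow> y \<in> E - D \<longrightarrow> x \<noteq> y \<longrightarrow>
       m (insert x D) * g (insert w (insert x D)) y = m (insert y D) * g (insert w (insert y D)) x)"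
    proof (rule insert.IH)
      show "g (insert w Y) a \<noteq> 0" if "Y \<subseteq> E" "card Y = s" "a \<in> E - Y" for Y a
        using that insert(2) Suc fin[of Y] by (intro nz) (auto simp: card_insert_if)
      show "g (insert w (insert x D)) y * g (insert w (insert y D)) z * g (insert w (insert z D)) x =
            g (insert w (insert x D)) z * g (insert w (insert y D)) x * g (insert w (insert z D)) y"
        if "D \<subseteq> E" "Suc (card D) = s" "x \<in> E - D" "y \<in> E - D" "z \<in> E - D"
          "x \<noteq> y" "y \<noteq> z" "x \<noteq> z" for D x y z
      proof -
        have "w \<notin> D" "x \<noteq> w" "y \<noteq> w" "z \<noteq> w" using that insert(2) by auto
        then show ?thesis
          using tri[of "insert w D" x y z] that Suc fin[of D]
          by (simp add: insert_commute subset_insertI2)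
      qed
    qed
    then obtain m where m0: "\<And>Y. m Y \<noteq> 0"
      and m: "\<And>D x y. D \<subseteq> E \<Longrightarrow> Suc (card D) = s \<Longrightarrow> x \<in> E - D \<Longrightarrow> y \<in> E - D \<Longrightarrow> x \<noteq> y \<Longrightarrow>
       m (insert x D) * g (insert w (insert x D)) y = m (insert y D) * g (insert w (insert y D)) x"
      by blast
    \<comment> \<open>The factor by which \<open>m D\<close> must be multiplied for \<open>l\<close>
      and \<open>m\<close> to match on the edge between \<open>insert y D\<close> and
      \<open>insert w D\<close>. Gluing requires it to be the same for all \<open>D\<close> and
      \<open>y\<close>.\<close>
    define \<kappa> where "\<kappa> D y = l (insert y D) * g (insert y D) w / (m D * g (insert w D) y)" for D y
    have \<kappa>0: "\<kappa> D y \<noteq> 0" if "D \<subseteq> E" "card D = s" "y \<in> E - D" for D y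
    proof -
      have "w \<notin> D" "y \<noteq> w" using that insert(2) by auto
      then have "g (insert y D) w \<noteq> 0" "g (insert w D) y \<noteq> 0"
        using that Suc fin[of D] by (intro nz; auto)+
      then show ?thesis using l0 m0 by (simp add: \<kappa>_def)
    qed
    \<comment> \<open>Independence of \<open>y\<close> is the triangle condition for
      \<open>y\<close>, \<open>z\<close>, \<open>w\<close> over \<open>D\<close>, with the edge
      between \<open>insert y D\<close> and \<open>insert z D\<close> eliminated by the relation for
      \<open>l\<close>.\<close>
    have \<kappa>1: "\<kappa> D y = \<kappa> D z" if "D \<subseteq> E" "card D = s" "y \<in> E - D" "z \<in> E - D" for D y z
    proof (cases "y = z")
      case False
      have "l (insert y D) * g (insert y D) z = l (insert z D) * g (insert z D) y"
        using that False Suc by (intro l) auto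
      moreover have "g (insert y D) z * g (insert z D) w * g (insert w D) y =
                     g (insert y D) w * g (insert z D) y * g (insert w D) z"
        using that False Suc insert(2) by (intro tri) auto
      moreover have "g (insert z D) y \<noteq> 0"
        using that False Suc insert(2) fin[of D] by (intro nz; auto simp: card_insert_if)
      ultimately have eq: "l (insert y D) * g (insert y D) w * g (insert w D) z =
        l (insert z D) * g (insert z D) w * g (insert w D) y"
        by (rule cross_cancel)
      have "g (insert w D) z \<noteq> 0" "g (insert w D) y \<noteq> 0"
        using that False Suc insert(2) fin[of D] by (intro nz; auto simp: card_insert_if)+
      then show ?thesis
        using \<open>g (insert w D) z \<noteq> 0\<close> \<open>g (insert w D) y \<noteq> 0\<close> m0[of D] eq
        by (simp add: \<kappa>_def frac_eq_eq mult_ac)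
    qed simp
    \<comment> \<open>The numerators coincide, and the denominators agree by the relation for
      \<open>m\<close>.\<close>
    have \<kappa>2: "\<kappa> (insert x G) y = \<kappa> (insert y G) x"
      if "G \<subseteq> E" "Suc (card G) = s" "x \<in> E - G" "y \<in> E - G" for G x y
    proof (cases "x = y")
      case False
      then show ?thesis using m[OF that] by (simp add: \<kappa>_def insert_commute)
    qed simp
    \<comment> \<open>By \<open>\<kappa>1\<close> any choice of \<open>y\<close> gives the same
      value; 1 is a filler for the case that no \<open>y\<close> is left.\<close>
    define c where "c D = (if E - D = {} then 1 else \<kappa> D (SOME y. y \<in> E - D))" for D
    have c: "c D = \<kappa> D y" if "D \<subseteq> E" "card D = s" "y \<in> E - D" for D y
    proof -
      have "(SOME y. y \<in> E - D) \<in> E - D" using that(3) by (rule someI)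
      then have "\<kappa> D (SOME y. y \<in> E - D) = \<kappa> D y" using that by (intro \<kappa>1) auto
      then show ?thesis using that(3) by (auto simp: c_def)
    qed
    have c_adj: "c (insert x G) = c (insert y G)"
      if "G \<subseteq> E" "Suc (card G) = s" "x \<in> E - G" "y \<in> E - G" for G x y
    proof (cases "x = y")
      case False
      have "c (insert x G) = \<kappa> (insert x G) y" "c (insert y G) = \<kappa> (insert y G) x"
        using that False fin[of G] by (auto intro!: c simp: card_insert_if)
      then show ?thesis using \<kappa>2[OF that] by simp
    qed simp
    have c_const: "c A = c B" if "A \<subseteq> E" "card A = s" "B \<subseteq> E" "card B = s" for A B
      using constant_on_subsets_of_card[where f = c, OF insert(1) c_adj that] by blast
    obtain k where k0: "k \<noteq> 0" and k: "\<And>D y. D \<subseteq> E \<Longrightarrow> card D = s \<Longrightarrow> y \<in> E - D \<Longrightarrow> \<kappa> D y = k"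
    proof (cases "\<exists>D y. D \<subseteq> E \<and> card D = s \<and> y \<in> E - D")
      case True
      then obtain D y where D: "D \<subseteq> E" "card D = s" "y \<in> E - D" by blast
      show ?thesis
      proof (rule that[of "\<kappa> D y"])
        show "\<kappa> D y \<noteq> 0" using \<kappa>0 D by blast
        show "\<kappa> D' y' = \<kappa> D y" if "D' \<subseteq> E" "card D' = s" "y' \<in> E - D'" for D' y'
          using c[OF that] c[OF D] c_const[OF that(1,2) D(1,2)] by simp
      qed
    next
      case False
      show ?thesis by (rule that[of 1]) (use False in auto)
    qed
    define L where "L Y = (if w \<in> Y then k * m (Y - {w}) else l Y)" for Y
    have mixed: "L (insert w D) * g (insert w D) y = L (insert y D) * g (insert y D) w"
      if "D \<subseteq> E" "card D = s" "y \<in> E - D" for D y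
    proof -
      have "w \<notin> D" "y \<noteq> w" using that insert(2) by auto
      then have "L (insert w D) = k * m D" "L (insert y D) = l (insert y D)"
        by (auto simp: L_def)
      moreover have "g (insert w D) y \<noteq> 0"
        using that insert(2) Suc fin[of D] by (intro nz) (auto simp: card_insert_if)
      ultimately show ?thesis
        using k[OF that, symmetric] m0[of D] by (simp add: \<kappa>_def)
    qed
    have "L (insert x D) * g (insert x D) y = L (insert y D) * g (insert y D) x"
      if D: "D \<subseteq> insert w E" "Suc (card D) = r" "x \<in> insert w E - D" "y \<in> insert w E - D" "x \<noteq> y"
      for D x y
    proof (cases "w \<in> D")
      case True
      define G where "G = D - {w}"
      have "finite D" using D insert(1) by (blast intro: finite_subset)
      then have G: "D = insert w G" "w \<notin> G" "G \<subseteq> E" "Suc (card G) = s"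
        using card.remove[of D w] True D Suc by (auto simp: G_def)
      have xy: "x \<in> E - G" "y \<in> E - G" using D G by auto
      then have "L (insert x D) = k * m (insert x G)" "L (insert y D) = k * m (insert y G)"
        using G insert(2) by (auto simp: L_def intro!: arg_cong[of _ _ m])
      then show ?thesis
        using m[OF G(3,4) xy D(5)] G(1) by (simp add: insert_commute)
    next
      case False
      then have DE: "D \<subseteq> E" "card D = s" using D Suc by auto
      consider "x = w" "y \<in> E - D" | "y = w" "x \<in> E - D" | "x \<in> E - D" "y \<in> E - D"
        using D by blast
      then show ?thesis
      proof cases
        case 1 then show ?thesis using mixed[OF DE] by simp
      next
        case 2 then show ?thesis using mixed[OF DE] by simp
      next
        case 3
        then have "w \<notin> insert x D" "w \<notin> insert y D" using False insert(2) by auto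
        then show ?thesis using l[OF DE(1) D(2) 3 D(5)] by (simp add: L_def)
      qed
    qed
    moreover have "L Y \<noteq> 0" for Y using k0 m0 l0 by (simp add: L_def)
    ultimately show ?thesis by (intro exI[of _ L]) blast
  qed
qed

subsection \<open>Interpolation over a finite field\<close>

text \<open>\<open>P\<close> equals its Lagrange interpolant \<open>Q\<close>, as both have degree
  below \<open>card A\<close>. Every \<open>L a\<close> is monic of degree
  \<open>card A - 1\<close>, so the coefficient of \<open>Q\<close> in that degree is the sum of the
  \<open>c a\<close>.\<close>

lemma lagrange_lead_coeff:
  fixes P :: "'f :: field poly"
  assumes fin: "finite A" and deg: "degree P < card A"
  shows "(\<Sum>a\<in>A. poly P a / (\<Prod>z\<in>A - {a}. a - z)) = Polynomial.coeff P (card A - 1)"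
proof -
  define L where "L a = (\<Prod>z\<in>A - {a}. [:- z, 1:])" for a
  define c where "c a = poly P a / (\<Prod>z\<in>A - {a}. a - z)" for a
  define Q where "Q = (\<Sum>a\<in>A. Polynomial.smult (c a) (L a))"
  have degL: "degree (L a) = card A - 1" and coeffL: "Polynomial.coeff (L a) (card A - 1) = 1"
    if "a \<in> A" for a
  proof -
    show "degree (L a) = card A - 1"
      using fin that by (simp add: L_def degree_prod_sum_eq)
    then show "Polynomial.coeff (L a) (card A - 1) = 1"
      using lead_coeff_prod[of "\<lambda>z. [:- z, 1:]" "A - {a}"] by (simp add: L_def)
  qed
  have "degree Q \<le> card A - 1"
    unfolding Q_def using degL
    by (intro degree_sum_le fin order.trans[OF degree_smult_le]) simp
  then have degQ: "degree Q < card A" using deg by linarith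
  have "poly P x = poly Q x" if x: "x \<in> A" for x
  proof -
    have L0: "poly (L a) x = 0" if "a \<in> A - {x}" for a
      using x that fin by (auto simp: L_def poly_prod)
    have "poly Q x = (\<Sum>a\<in>A. c a * poly (L a) x)"
      by (simp add: Q_def poly_sum)
    also have "\<dots> = c x * poly (L x) x"
      using sum.remove[of A x "\<lambda>a. c a * poly (L a) x"] x fin L0 by simp
    also have "poly (L x) x = (\<Prod>z\<in>A - {x}. x - z)"
      by (simp add: L_def poly_prod)
    also have "c x * \<dots> = poly P x"
      using fin by (simp add: c_def)
    finally show ?thesis by simp
  qed
  then have "P = Q" using deg degQ by (rule poly_eqI_degree)
  then have "Polynomial.coeff P (card A - 1) = (\<Sum>a\<in>A. c a * Polynomial.coeff (L a) (card A - 1))"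
    by (simp add: Q_def coeff_sum)
  then show ?thesis using coeffL by (simp add: c_def)
qed

lemma finite_field_fermat:
  fixes x :: "'f :: {field, finite}"
  assumes "x \<noteq> 0"
  shows "x ^ (CARD('f) - 1) = 1"
proof -
  have "(\<Prod>c\<in>UNIV - {0}. c) = (\<Prod>c\<in>UNIV - {0}. x * c)"
    using assms
    by (intro prod.reindex_bij_witness[of _ "\<lambda>c. x * c" "\<lambda>c. c / x"]) auto
  also have "\<dots> = x ^ (CARD('f) - 1) * (\<Prod>c\<in>UNIV - {0}. c)"
    by (simp add: prod.distrib)
  finally show ?thesis by simp
qed

text \<open>Wilson's theorem. The product is the same \<open>\<omega>\<close> for every
  \<open>s\<close>; interpolating the monomial of degree \<open>CARD('f) - 1\<close> on the whole
  field gives, by Fermat, \<open>1 = (of_nat CARD('f) - 1) / \<omega>\<close>, where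
  \<open>of_nat CARD('f)\<close> is zero.\<close>

lemma finite_field_prod_diff:
  fixes s :: "'f :: {field, finite}"
  shows "(\<Prod>c\<in>UNIV - {s}. s - c) = - 1"
proof -
  define \<omega> where "\<omega> = (\<Prod>c\<in>UNIV - {0 :: 'f}. c)"
  have \<omega>: "(\<Prod>c\<in>UNIV - {a}. a - c) = \<omega>" for a :: 'f
    unfolding \<omega>_def
    by (rule prod.reindex_bij_witness[of _ "\<lambda>c. a - c" "\<lambda>c. a - c"]) auto
  have \<omega>0: "\<omega> \<noteq> 0" by (simp add: \<omega>_def)
  have "card {0, 1 :: 'f} \<le> CARD('f)" by (intro card_mono) auto
  then have q: "CARD('f) \<ge> 2" by simp
  have "1 = Polynomial.coeff (Polynomial.monom (1 :: 'f) (CARD('f) - 1)) (CARD('f) - 1)" by simp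
  also have "\<dots> = (\<Sum>a\<in>UNIV. a ^ (CARD('f) - 1) / \<omega>)"
    using lagrange_lead_coeff[of UNIV "Polynomial.monom (1 :: 'f) (CARD('f) - 1)"] q
    by (simp add: \<omega> degree_monom_eq poly_monom)
  also have "\<dots> = (\<Sum>a\<in>UNIV - {0}. a ^ (CARD('f) - 1) / \<omega>)"
    using sum.remove[of UNIV "0 :: 'f" "\<lambda>a. a ^ (CARD('f) - 1) / \<omega>"] q by simp
  also have "\<dots> = (\<Sum>a\<in>UNIV - {0 :: 'f}. 1 / \<omega>)"
    by (intro sum.cong refl) (subst finite_field_fermat; simp)
  also have "\<dots> = (of_nat CARD('f) - 1) / \<omega>"
    using q by (simp add: of_nat_diff)
  also have "of_nat CARD('f) = (0 :: 'f)"
    using CHAR_dvd_CARD[where 'a = 'f] by (simp add: of_nat_eq_0_iff_char_dvd)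
  finally have "\<omega> = - 1" using \<omega>0 by (simp add: field_simps)
  then show ?thesis using \<omega> by simp
qed

text \<open>By Wilson's theorem \<open>1 / (\<Prod>u\<in>B - {a}. a - u)\<close> is minus the value at \<open>a\<close> of the
  polynomial vanishing on the complement of \<open>B\<close>.\<close>

lemma sum_inverse_prod_diff:
  fixes A B :: "'f :: {field, finite} set"
  assumes AB: "A \<subseteq> B" and card: "card A + card B = CARD('f) + 1"
  shows "(\<Sum>a\<in>A. 1 / ((\<Prod>u\<in>B - {a}. a - u) * (\<Prod>z\<in>A - {a}. a - z))) = - 1"
proof -
  define P where "P = (\<Prod>c\<in>- B. [:- c, 1:])"
  have "card B \<le> CARD('f)" by (intro card_mono) auto
  \<comment> \<open>The cardinality condition makes the degree of \<open>P\<close> exactly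
    \<open>card A - 1\<close>, the degree whose coefficient Lagrange interpolation extracts.\<close>
  then have cA: "card (- B) = card A - 1" "card A > 0"
    using card by (auto simp: Compl_eq_Diff_UNIV card_Diff_subset)
  have degP: "degree P = card A - 1"
    using cA by (simp add: P_def degree_prod_sum_eq)
  then have lcP: "Polynomial.coeff P (card A - 1) = 1"
    using lead_coeff_prod[of "\<lambda>z. [:- z, 1:]" "- B"] by (simp add: P_def)
  have "1 / (\<Prod>u\<in>B - {a}. a - u) = - poly P a" if "a \<in> A" for a
  proof -
    have "(\<Prod>u\<in>(B - {a}) \<union> - B. a - u) = (\<Prod>u\<in>B - {a}. a - u) * (\<Prod>c\<in>- B. a - c)"
      by (rule prod.union_disjoint) auto
    moreover have "(B - {a}) \<union> - B = UNIV - {a}" using that AB by auto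
    ultimately have "(\<Prod>u\<in>B - {a}. a - u) * (\<Prod>c\<in>- B. a - c) = - 1"
      by (simp only: finite_field_prod_diff)
    moreover have "poly P a = (\<Prod>c\<in>- B. a - c)" by (simp add: P_def poly_prod)
    ultimately have "(\<Prod>u\<in>B - {a}. a - u) * poly P a = - 1" by (simp only:)
    moreover have "1 / p = - v" if "p * v = - 1" for p v :: 'f
      using that by (cases "p = 0") (auto simp: field_simps)
    ultimately show ?thesis by blast
  qed
  then have "(\<Sum>a\<in>A. 1 / ((\<Prod>u\<in>B - {a}. a - u) * (\<Prod>z\<in>A - {a}. a - z))) =
      (\<Sum>a\<in>A. - (poly P a / (\<Prod>z\<in>A - {a}. a - z)))"
    by (intro sum.cong refl) (simp only: divide_divide_eq_left[symmetric] minus_divide_left)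
  also have "\<dots> = - 1"
    using lagrange_lead_coeff[of A P] cA degP lcP by (simp add: sum_negf)
  finally show ?thesis .
qed

text \<open>The pairs \<open>(f u, g u)\<close> are points of the projective line, with
  \<open>a0\<close> at infinity and \<open>f u / g u\<close> as affine coordinate. A factor with
  \<open>u \<noteq> a0\<close> is \<open>g a * g u\<close> times a difference of coordinates; the
  factor at \<open>a0\<close> is \<open>- g a\<close>, which completes the product of the
  \<open>g u\<close> over \<open>X - {a0}\<close>.\<close>

lemma alternating_prod:
  fixes f g :: "'i \<Rightarrow> 'f :: field"
  assumes "finite X" "a0 \<in> X" "a \<in> X" "a \<noteq> a0" "f a0 = 1" "g a0 = 0"
    and g0: "\<And>u. u \<in> X \<Longrightarrow> u \<noteq> a0 \<Longrightarrow> g u \<noteq> 0"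
    and inj: "inj_on (\<lambda>u. f u / g u) (X - {a0})"
  shows "(\<Prod>u\<in>X - {a}. f a * g u - g a * f u) =
    - (g a ^ (card X - 2)) * (\<Prod>u\<in>X - {a0}. g u) *
    (\<Prod>y\<in>(\<lambda>u. f u / g u) ` (X - {a0}) - {f a / g a}. f a / g a - y)"
proof -
  let ?s = "\<lambda>u. f u / g u"
  let ?Z = "X - {a0} - {a}"
  have ga: "g a \<noteq> 0" using assms by auto
  have eq: "X - {a} = insert a0 ?Z" using assms by auto
  have "(\<Prod>u\<in>X - {a}. f a * g u - g a * f u) =
      - g a * (\<Prod>u\<in>?Z. f a * g u - g a * f u)"
    unfolding eq using assms(1,5,6) by (subst prod.insert) auto
  also have "(\<Prod>u\<in>?Z. f a * g u - g a * f u) = (\<Prod>u\<in>?Z. g a * g u * (?s a - ?s u))"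
    using g0 ga by (intro prod.cong) (auto simp: field_simps)
  also have "\<dots> = g a ^ card ?Z * (\<Prod>u\<in>?Z. g u) * (\<Prod>u\<in>?Z. ?s a - ?s u)"
    by (simp add: prod.distrib)
  also have "card ?Z = card X - 2" using assms by simp
  also have "(\<Prod>u\<in>?Z. ?s a - ?s u) = (\<Prod>y\<in>?s ` (X - {a0}) - {?s a}. ?s a - y)"
  proof -
    have "?s ` (X - {a0}) - {?s a} = ?s ` ?Z"
      using inj assms(3,4) by (auto simp: inj_on_def)
    moreover have "inj_on ?s ?Z" using inj by (rule inj_on_subset) auto
    ultimately show ?thesis by (simp add: prod.reindex)
  qed
  also have "- g a * (g a ^ (card X - 2) * (\<Prod>u\<in>?Z. g u) *
      (\<Prod>y\<in>?s ` (X - {a0}) - {?s a}. ?s a - y)) =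
    - (g a ^ (card X - 2)) * (g a * (\<Prod>u\<in>?Z. g u)) *
      (\<Prod>y\<in>?s ` (X - {a0}) - {?s a}. ?s a - y)"
    by (simp add: mult_ac)
  also have "g a * (\<Prod>u\<in>?Z. g u) = (\<Prod>u\<in>X - {a0}. g u)"
    using prod.remove[of "X - {a0}" a g] assms(1,3,4) by simp
  finally show ?thesis .
qed

text \<open>The summands other than that of \<open>a0\<close> are \<open>1 / G\<close> times those
  of \<open>sum_inverse_prod_diff\<close>, so they add up to \<open>- (1 / G)\<close>, and the
  summand at \<open>a0\<close> is \<open>1 / G\<close>. Removing \<open>a0\<close> from both sets
  lowers the total cardinality by 2, as that lemma needs.\<close>

lemma sum_inverse_prod_alternating_aux:
  fixes f g :: "'i \<Rightarrow> 'f :: {field, finite}"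
  assumes fin: "finite B" and AB: "A \<subseteq> B" and card: "card A + card B = CARD('f) + 3"
    and nz: "\<And>a b. a \<in> B \<Longrightarrow> b \<in> B \<Longrightarrow> a \<noteq> b \<Longrightarrow> f a * g b - g a * f b \<noteq> 0"
    and a0: "a0 \<in> A" "f a0 = 1" "g a0 = 0"
  shows "(\<Sum>a\<in>A. 1 / ((\<Prod>u\<in>B - {a}. f a * g u - g a * f u) *
                       (\<Prod>z\<in>A - {a}. f a * g z - g a * f z))) = 0"
proof -
  let ?s = "\<lambda>u. f u / g u"
  let ?t = "\<lambda>a. 1 / ((\<Prod>u\<in>B - {a}. f a * g u - g a * f u) *
                       (\<Prod>z\<in>A - {a}. f a * g z - g a * f z))"
  define A' where "A' = A - {a0}"
  define B' where "B' = B - {a0}"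
  define G where "G = (\<Prod>u\<in>B'. g u) * (\<Prod>u\<in>A'. g u)"
  have finA: "finite A" using fin AB by (rule rev_finite_subset)
  have a0B: "a0 \<in> B" using a0 AB by auto
  have g0: "g u \<noteq> 0" if "u \<in> B" "u \<noteq> a0" for u
    using nz[of a0 u] that a0 a0B by auto
  have inj: "inj_on ?s B'"
  proof (rule inj_onI, rule ccontr)
    fix u v assume uv: "u \<in> B'" "v \<in> B'" "?s u = ?s v" "u \<noteq> v"
    then have "f u * g v = f v * g u"
      using g0[of u] g0[of v] by (auto simp: B'_def frac_eq_eq)
    then show False using nz[of u v] uv by (auto simp: B'_def mult.commute)
  qed
  have injA: "inj_on ?s A'" using inj by (rule inj_on_subset) (use AB in \<open>auto simp: A'_def B'_def\<close>)
  have cardA: "card A = Suc (card A')" unfolding A'_def by (rule card.remove[OF finA a0(1)])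
  have cardB: "card B = Suc (card B')" unfolding B'_def by (rule card.remove[OF fin a0B])
  have G0: "G \<noteq> 0" using g0 fin finA AB by (auto simp: G_def A'_def B'_def)
  have t: "?t a = 1 / G * (1 / ((\<Prod>y\<in>?s ` B' - {?s a}. ?s a - y) * (\<Prod>y\<in>?s ` A' - {?s a}. ?s a - y)))"
    if a: "a \<in> A'" for a
  proof -
    have aA: "a \<in> A" "a \<in> B" "a \<noteq> a0" using a AB by (auto simp: A'_def)
    have eB: "(\<Prod>u\<in>B - {a}. f a * g u - g a * f u) =
      - (g a ^ (card B - 2)) * (\<Prod>u\<in>B'. g u) * (\<Prod>y\<in>?s ` B' - {?s a}. ?s a - y)"
      unfolding B'_def
      by (rule alternating_prod) (use fin a0B aA a0 g0 inj in \<open>auto simp: B'_def\<close>)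
    have eA: "(\<Prod>u\<in>A - {a}. f a * g u - g a * f u) =
      - (g a ^ (card A - 2)) * (\<Prod>u\<in>A'. g u) * (\<Prod>y\<in>?s ` A' - {?s a}. ?s a - y)"
      unfolding A'_def
      by (rule alternating_prod) (use finA a0 aA g0 injA AB in \<open>auto simp: A'_def\<close>)
    have "card A' > 0" "card B' > 0"
      using a aA fin finA by (auto simp: A'_def B'_def card_gt_0_iff)
    \<comment> \<open>The powers of \<open>g a\<close> in the two products have total exponent
      \<open>CARD('f) - 1\<close>, so Fermat removes them.\<close>
    then have "(card B - 2) + (card A - 2) = CARD('f) - 1"
      using card cardA cardB by linarith
    then have "g a ^ (card B - 2) * g a ^ (card A - 2) = 1"
      using finite_field_fermat[of "g a"] g0[of a] aA by (simp flip: power_add)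
    moreover have "- p * b * x * (- r * c * y) = p * r * (b * c * (x * y))" for p r b c x y :: 'f
      by (simp add: mult_ac)
    ultimately have "(\<Prod>u\<in>B - {a}. f a * g u - g a * f u) * (\<Prod>u\<in>A - {a}. f a * g u - g a * f u) =
       G * ((\<Prod>y\<in>?s ` B' - {?s a}. ?s a - y) * (\<Prod>y\<in>?s ` A' - {?s a}. ?s a - y))"
      unfolding eA eB G_def by (simp only: mult_1_left)
    then show ?thesis by (simp only: divide_divide_eq_left times_divide_times_eq mult_1_left)
  qed
  have "(\<Sum>a\<in>A'. ?t a) = 1 / G * (\<Sum>a\<in>A'. 1 / ((\<Prod>y\<in>?s ` B' - {?s a}. ?s a - y) *
      (\<Prod>y\<in>?s ` A' - {?s a}. ?s a - y)))"
    unfolding sum_distrib_left using t by (intro sum.cong) auto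
  also have "\<dots> = 1 / G * (\<Sum>x\<in>?s ` A'. 1 / ((\<Prod>y\<in>?s ` B' - {x}. x - y) * (\<Prod>y\<in>?s ` A' - {x}. x - y)))"
    using injA by (simp add: sum.reindex)
  also have "(\<Sum>x\<in>?s ` A'. 1 / ((\<Prod>y\<in>?s ` B' - {x}. x - y) * (\<Prod>y\<in>?s ` A' - {x}. x - y))) = - 1"
  proof (rule sum_inverse_prod_diff)
    show "?s ` A' \<subseteq> ?s ` B'" using AB by (auto simp: A'_def B'_def)
    show "card (?s ` A') + card (?s ` B') = CARD('f) + 1"
      using inj injA card cardA cardB by (simp add: card_image)
  qed
  finally have "(\<Sum>a\<in>A'. ?t a) = - (1 / G)" by simp
  moreover have "?t a0 = 1 / G"
    using a0 by (simp add: G_def A'_def B'_def)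
  moreover have "(\<Sum>a\<in>A. ?t a) = ?t a0 + (\<Sum>a\<in>A'. ?t a)"
    unfolding A'_def by (rule sum.remove[OF finA a0(1)])
  ultimately show ?thesis by simp
qed

text \<open>Only determinants of \<open>f\<close> and \<open>g\<close> enter, so a change of basis
  of determinant 1 may bring \<open>a0\<close> to the position \<open>(1, 0)\<close>.\<close>

lemma sum_inverse_prod_alternating:
  fixes f g :: "'i \<Rightarrow> 'f :: {field, finite}"
  assumes fin: "finite B" and AB: "A \<subseteq> B" and card: "card A + card B = CARD('f) + 3"
    and A2: "card A \<ge> 2"
    and nz: "\<And>a b. a \<in> B \<Longrightarrow> b \<in> B \<Longrightarrow> a \<noteq> b \<Longrightarrow> f a * g b - g a * f b \<noteq> 0"
  shows "(\<Sum>a\<in>A. 1 / ((\<Prod>u\<in>B - {a}. f a * g u - g a * f u) *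
                       (\<Prod>z\<in>A - {a}. f a * g z - g a * f z))) = 0"
proof -
  obtain a0 b0 where ab: "a0 \<in> A" "b0 \<in> A" "a0 \<noteq> b0"
    using A2 card_le_Suc0_iff_eq[OF finite_subset[OF AB fin]] by fastforce
  define \<delta> where "\<delta> a b = f a * g b - g a * f b" for a b
  define f' where "f' x = \<delta> x b0 / \<delta> a0 b0" for x
  define g' where "g' x = \<delta> a0 x" for x
  have d0: "\<delta> a0 b0 \<noteq> 0" using nz[of a0 b0] ab AB by (auto simp: \<delta>_def)
  have eq: "f' a * g' b - g' a * f' b = f a * g b - g a * f b" for a b
  proof -
    \<comment> \<open>The Pluecker relation between four vectors of a plane.\<close>
    have "\<delta> a b0 * \<delta> a0 b - \<delta> a0 a * \<delta> b b0 = \<delta> a0 b0 * (f a * g b - g a * f b)"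
      unfolding \<delta>_def by (simp add: algebra_simps)
    moreover have "f' a * g' b - g' a * f' b = (\<delta> a b0 * \<delta> a0 b - \<delta> a0 a * \<delta> b b0) / \<delta> a0 b0"
      by (simp add: f'_def g'_def diff_divide_distrib)
    ultimately show ?thesis using d0 by simp
  qed
  have "(\<Sum>a\<in>A. 1 / ((\<Prod>u\<in>B - {a}. f' a * g' u - g' a * f' u) *
                       (\<Prod>z\<in>A - {a}. f' a * g' z - g' a * f' z))) = 0"
  proof (rule sum_inverse_prod_alternating_aux[OF fin AB card _ ab(1)])
    show "f' a * g' b - g' a * f' b \<noteq> 0" if "a \<in> B" "b \<in> B" "a \<noteq> b" for a b
      unfolding eq using nz that by blast
    show "f' a0 = 1" using d0 by (simp add: f'_def)
    show "g' a0 = 0" by (simp add: g'_def \<delta>_def)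
  qed
  then show ?thesis by (simp only: eq)
qed

subsection \<open>MDS codes\<close>

text \<open>That any \<open>k\<close> coordinates determine a codeword is split into existence
  (\<open>interpolate\<close>) and uniqueness (\<open>vanish\<close>), which avoids vector space
  dimensions. Codewords are functions on the whole type, but only values on \<open>I\<close> count,
  so uniqueness is claimed only there.\<close>

locale mds_code =
  fixes W :: "('i \<Rightarrow> 'f :: field) set" and I :: "'i set" and k :: nat
  assumes fin: "finite I" and k_le: "k \<le> card I"
    and lin: "v \<in> W \<Longrightarrow> w \<in> W \<Longrightarrow> (\<lambda>i. a * v i + b * w i) \<in> W"
    and interpolate: "K \<subseteq> I \<Longrightarrow> card K = k \<Longrightarrow> \<exists>w\<in>W. \<forall>i\<in>K. w i = h i"
    and vanish: "w \<in> W \<Longrightarrow> K \<subseteq> I \<Longrightarrow> card K = k \<Longrightarrow> (\<And>i. i \<in> K \<Longrightarrow> w i = 0) \<Longrightarrow>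
      i \<in> I \<Longrightarrow> w i = 0"
begin

lemma fin_sub: "K \<subseteq> I \<Longrightarrow> finite K"
  using fin by (rule rev_finite_subset)

lemma determined:
  assumes "v \<in> W" "w \<in> W" "K \<subseteq> I" "card K = k" "\<And>i. i \<in> K \<Longrightarrow> v i = w i" "i \<in> I"
  shows "v i = w i"
  using vanish[OF lin[OF assms(1,2), of 1 "- 1"] assms(3,4) _ assms(6)] assms(5) by simp

lemma unit_word:
  "K \<subseteq> I \<Longrightarrow> card K = k \<Longrightarrow> \<exists>w\<in>W. \<forall>i\<in>K. w i = (if i = j then 1 else 0)"
  by (rule interpolate)

lemma sum_closed:
  assumes "finite F" "\<And>j. j \<in> F \<Longrightarrow> w j \<in> W"
  shows "(\<lambda>i. \<Sum>j\<in>F. c j * w j i) \<in> W"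
  using assms
proof (induction F rule: finite_induct)
  case empty
  obtain K where "K \<subseteq> I" "card K = k" using obtain_subset_with_card_n[OF k_le] by metis
  then obtain v where "v \<in> W" using interpolate by blast
  then show ?case using lin[of v v 0 0] by simp
next
  case (insert j F)
  then show ?case using lin[of "w j" "\<lambda>i. \<Sum>j\<in>F. c j * w j i" "c j" 1] by simp
qed

text \<open>If \<open>L\<close> has \<open>card I - k\<close> elements, \<open>W\<close> has a basis
  \<open>e\<close> that restricts to unit words on \<open>I - L\<close>. Orthogonality to
  \<open>e\<close> extends any values on \<open>L\<close> to \<open>I\<close> in exactly one way.
  Duality serves to trade a large dimension for a small one.\<close>

lemma dual: "mds_code {c. \<forall>w\<in>W. (\<Sum>i\<in>I. c i * w i) = 0} I (card I - k)"
proof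
  let ?D = "{c. \<forall>w\<in>W. (\<Sum>i\<in>I. c i * w i) = 0}"
  show "finite I" by (rule fin)
  show "card I - k \<le> card I" by simp
  show "(\<lambda>i. a * v i + b * w i) \<in> ?D" if "v \<in> ?D" "w \<in> ?D" for v w a b
  proof -
    have "(\<Sum>i\<in>I. (a * v i + b * w i) * u i) = a * (\<Sum>i\<in>I. v i * u i) + b * (\<Sum>i\<in>I. w i * u i)"
      for u
      by (simp add: sum_distrib_left algebra_simps sum.distrib)
    then show ?thesis using that by simp
  qed
  have unit: "\<exists>e. (\<forall>i\<in>I - L. e i \<in> W) \<and> (\<forall>i\<in>I - L. \<forall>j\<in>I - L. e i j = (if j = i then 1 else 0))"
    and cardK: "card (I - L) = k"
    if L: "L \<subseteq> I" "card L = card I - k" for L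
  proof -
    show K: "card (I - L) = k"
      using L k_le by (simp add: card_Diff_subset fin_sub)
    have "\<forall>i. \<exists>w\<in>W. \<forall>j\<in>I - L. w j = (if j = i then 1 else 0)"
      using unit_word[OF _ K] by blast
    then obtain e where "\<forall>i. e i \<in> W \<and> (\<forall>j\<in>I - L. e i j = (if j = i then 1 else 0))"
      by metis
    then show "\<exists>e. (\<forall>i\<in>I - L. e i \<in> W) \<and> (\<forall>i\<in>I - L. \<forall>j\<in>I - L. e i j = (if j = i then 1 else 0))"
      by blast
  qed
  show "\<exists>c\<in>?D. \<forall>i\<in>L. c i = h i" if L: "L \<subseteq> I" "card L = card I - k" for L h
  proof -
    define K where "K = I - L"
    obtain e where e: "\<And>i. i \<in> K \<Longrightarrow> e i \<in> W"
      "\<And>i j. i \<in> K \<Longrightarrow> j \<in> K \<Longrightarrow> e i j = (if j = i then 1 else 0)"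
      using unit[OF L] unfolding K_def by metis
    have finK: "finite K" "finite L" using fin_sub L by (auto simp: K_def fin)
    \<comment> \<open>Outside \<open>L\<close> the value at \<open>i\<close> is forced by
      orthogonality to \<open>e i\<close>, which is 1 at \<open>i\<close> and 0 on the rest of
      \<open>K\<close>.\<close>
    define c where "c i = (if i \<in> L then h i else - (\<Sum>j\<in>L. h j * e i j))" for i
    have "(\<Sum>i\<in>I. c i * w i) = 0" if w: "w \<in> W" for w
    proof -
      have exp: "w j = (\<Sum>i\<in>K. w i * e i j)" if j: "j \<in> I" for j
      proof (rule determined[OF w sum_closed _ _ _ j])
        show "e i \<in> W" if "i \<in> K" for i using e that by auto
        show "K \<subseteq> I" "card K = k" using cardK[OF L] by (auto simp: K_def)
        show "w i = (\<Sum>j\<in>K. w j * e j i)" if "i \<in> K" for i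
        proof -
          have "(\<Sum>j\<in>K. w j * e j i) = (\<Sum>j\<in>K. if j = i then w j else 0)"
            using e(2) that by (intro sum.cong) auto
          then show ?thesis using finK that by simp
        qed
      qed (use finK in auto)
      have "(\<Sum>i\<in>K. c i * w i) = (\<Sum>i\<in>K. - (\<Sum>j\<in>L. h j * (w i * e i j)))"
        by (intro sum.cong) (auto simp: c_def K_def sum_distrib_left sum_distrib_right mult_ac)
      also have "\<dots> = - (\<Sum>i\<in>K. \<Sum>j\<in>L. h j * (w i * e i j))"
        by (rule sum_negf)
      also have "(\<Sum>i\<in>K. \<Sum>j\<in>L. h j * (w i * e i j)) = (\<Sum>j\<in>L. h j * (\<Sum>i\<in>K. w i * e i j))"
        unfolding sum_distrib_left by (rule sum.swap)
      also have "\<dots> = (\<Sum>j\<in>L. c j * w j)"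
      proof (intro sum.cong refl)
        fix j assume "j \<in> L"
        then show "h j * (\<Sum>i\<in>K. w i * e i j) = c j * w j"
          using L exp[of j] by (auto simp: c_def)
      qed
      finally have "(\<Sum>i\<in>K. c i * w i) + (\<Sum>j\<in>L. c j * w j) = 0" by simp
      moreover have "(\<Sum>i\<in>I. c i * w i) = (\<Sum>i\<in>K. c i * w i) + (\<Sum>j\<in>L. c j * w j)"
        unfolding K_def by (rule sum.subset_diff[OF L(1) fin])
      ultimately show ?thesis by simp
    qed
    then show ?thesis by (intro bexI[of _ c]) (auto simp: c_def)
  qed
  show "c i = 0"
    if c: "c \<in> ?D" and L: "L \<subseteq> I" "card L = card I - k"
      and cL: "\<And>i. i \<in> L \<Longrightarrow> c i = 0" and i: "i \<in> I" for c L i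
  proof (cases "i \<in> L")
    case False
    then have iK: "i \<in> I - L" using i by simp
    obtain e where e: "e \<in> W" "\<And>j. j \<in> I - L \<Longrightarrow> e j = (if j = i then 1 else 0)"
      using unit[OF L] iK by metis
    \<comment> \<open>As \<open>c\<close> vanishes on \<open>L\<close> and \<open>e\<close> is a
      unit word on \<open>I - L\<close>, orthogonality isolates \<open>c i\<close>.\<close>
    have "0 = (\<Sum>j\<in>I. c j * e j)" using c e(1) by simp
    also have "\<dots> = (\<Sum>j\<in>I. if j = i then c j else 0)"
    proof (intro sum.cong refl)
      fix j assume "j \<in> I"
      then show "c j * e j = (if j = i then c j else 0)"
        using cL[of j] e(2)[of j] False by (cases "j \<in> L") auto
    qed
    also have "\<dots> = c i" using i fin by simp
    finally show ?thesis by simp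
  qed (rule cL)
qed

text \<open>The codewords vanishing on a set \<open>Y\<close> of size \<open>k - 2\<close> form a plane; \<open>alternating_at Y d\<close>
  says that \<open>d\<close> is a non-zero alternating bilinear form on its dual, evaluated at the coordinates.\<close>

definition alternating_at :: "'i set \<Rightarrow> ('i \<Rightarrow> 'i \<Rightarrow> 'f) \<Rightarrow> bool" where
  "alternating_at Y d \<longleftrightarrow>
     (\<exists>f g. \<forall>a b. d a b = f a * g b - g a * f b) \<and>
     (\<forall>a\<in>I - Y. \<forall>b\<in>I - Y. a \<noteq> b \<longrightarrow> d a b \<noteq> 0) \<and>
     (\<forall>w\<in>W. (\<forall>y\<in>Y. w y = 0) \<longrightarrow>
        (\<forall>a\<in>I. \<forall>b\<in>I. \<forall>c\<in>I. w a * d b c + w b * d c a + w c * d a b = 0))"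

text \<open>\<open>f\<close> and \<open>g\<close> are the basis of the plane dual to two coordinates
  \<open>b1\<close>, \<open>b2\<close> outside \<open>Y\<close>, and \<open>d\<close> is their
  determinant. The cyclic identity expands a 3 by 3 determinant with dependent rows
  \<open>w\<close>, \<open>f\<close>, \<open>g\<close>.\<close>

lemma ex_alternating_at:
  assumes Y: "Y \<subseteq> I" "Suc (Suc (card Y)) = k"
  shows "\<exists>d. alternating_at Y d"
proof -
  have finY: "finite Y" using Y fin_sub by blast
  have card_insert2: "card (insert a (insert b Y)) = k" if "a \<in> I - Y" "b \<in> I - Y" "a \<noteq> b" for a b
    using that finY Y by simp
  have "card (I - Y) = card I - card Y" using Y finY by (simp add: card_Diff_subset)
  then have "2 \<le> card (I - Y)" using Y k_le by simp
  then obtain B where B: "B \<subseteq> I - Y" "card B = 2" by (rule obtain_subset_with_card_n)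
  then obtain b1 b2 where b: "b1 \<in> I - Y" "b2 \<in> I - Y" "b1 \<noteq> b2"
    unfolding card_2_iff by auto
  let ?K = "insert b1 (insert b2 Y)"
  have K: "?K \<subseteq> I" "card ?K = k" using b Y card_insert2[OF b] by auto
  obtain f where "f \<in> W" "\<forall>i\<in>?K. f i = (if i = b1 then 1 else 0)"
    using unit_word[OF K] by blast
  then have f: "f \<in> W" "f b1 = 1" "f b2 = 0" "\<And>y. y \<in> Y \<Longrightarrow> f y = 0"
    using b by auto
  obtain g where "g \<in> W" "\<forall>i\<in>?K. g i = (if i = b2 then 1 else 0)"
    using unit_word[OF K] by blast
  then have g: "g \<in> W" "g b1 = 0" "g b2 = 1" "\<And>y. y \<in> Y \<Longrightarrow> g y = 0"
    using b by auto
  define d where "d a b = f a * g b - g a * f b" for a b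
  have "d a b \<noteq> 0" if ab: "a \<in> I - Y" "b \<in> I - Y" "a \<noteq> b" for a b
  proof
    assume d0: "d a b = 0"
    have zero: "w i = 0" if "w \<in> W" "\<And>y. y \<in> Y \<Longrightarrow> w y = 0" "w a = 0" "w b = 0" "i \<in> I" for w i
      by (rule vanish[OF that(1) _ card_insert2[OF ab]]) (use that ab Y in auto)
    have "d b a = - d a b" "d a a = 0" "d b b = 0" by (simp_all add: d_def)
    then have d0': "d b a = 0" "d a a = 0" "d b b = 0" using d0 by simp_all
    \<comment> \<open>The word \<open>g x * f - f x * g\<close> vanishes on \<open>Y\<close>, at
      \<open>a\<close> and at \<open>b\<close>, hence on \<open>I\<close>; its values at
      \<open>b1\<close> and \<open>b2\<close> are \<open>g x\<close> and \<open>- f x\<close>. For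
      \<open>x = a\<close> and \<open>x = b\<close> this makes \<open>f\<close> itself vanish at
      \<open>a\<close> and \<open>b\<close>.\<close>
    have comb: "g x = 0 \<and> f x = 0" if x: "d x a = 0" "d x b = 0" for x
    proof -
      have eq: "g x * f i + - f x * g i = - d x i" for i by (simp add: d_def)
      have "g x * f i + - f x * g i = 0" if "i \<in> I" for i
        by (rule zero[OF lin[OF f(1) g(1)] _ _ _ that])
          (simp_all only: eq x, simp_all add: f g d_def)
      from this[of b1] this[of b2] show ?thesis using b f g by simp
    qed
    have "f b1 = 0"
      by (rule zero[OF f(1,4)]) (use comb[of a] comb[of b] d0 d0' b in auto)
    then show False using f by simp
  qed
  moreover have "w x * d y z + w y * d z x + w z * d x y = 0"
    if w: "w \<in> W" "\<forall>y\<in>Y. w y = 0" and xyz: "x \<in> I" "y \<in> I" "z \<in> I" for w x y z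
  proof -
    have "w i = w b1 * f i + w b2 * g i" if "i \<in> I" for i
      by (rule determined[OF w(1) lin[OF f(1) g(1)] K _ that]) (use w f g in auto)
    then have exp: "w x = w b1 * f x + w b2 * g x" "w y = w b1 * f y + w b2 * g y"
      "w z = w b1 * f z + w b2 * g z"
      using xyz by blast+
    have "(p * f x + q * g x) * d y z + (p * f y + q * g y) * d z x + (p * f z + q * g z) * d x y = 0"
      for p q
      unfolding d_def by (simp add: algebra_simps)
    then show ?thesis unfolding exp .
  qed
  ultimately have "alternating_at Y d"
    unfolding alternating_at_def by (auto simp: d_def)
  then show ?thesis by blast
qed

lemma alternating_at_antisym: "alternating_at Y d \<Longrightarrow> d a b = - d b a"
  unfolding alternating_at_def by auto

lemma alternating_at_nonzero:
  "alternating_at Y d \<Longrightarrow> a \<in> I - Y \<Longrightarrow> b \<in> I - Y \<Longrightarrow> a \<noteq> b \<Longrightarrow> d a b \<noteq> 0"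
  unfolding alternating_at_def by blast

lemma alternating_at_cyclic:
  assumes "alternating_at Y d" "w \<in> W" "\<forall>y\<in>Y. w y = 0" "a \<in> I" "b \<in> I" "c \<in> I"
  shows "w a * d b c + w b * d c a + w c * d a b = 0"
  using assms unfolding alternating_at_def by blast

text \<open>The determinant identity behind Segre's lemma of tangents.\<close>

lemma alternating_at_triangle:
  assumes D: "D \<subseteq> I" "Suc (Suc (Suc (card D))) = k"
    and x: "x \<in> I - D" and y: "y \<in> I - D" and z: "z \<in> I - D"
    and ne: "x \<noteq> y" "y \<noteq> z" "x \<noteq> z" and u: "u \<in> I"
    and d: "alternating_at (insert x D) d1" "alternating_at (insert y D) d2" "alternating_at (insert z D) d3"
  shows "d1 y u * d2 z u * d3 x u = - (d1 z u * d2 x u * d3 y u)"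
proof -
  let ?K = "insert x (insert y (insert z D))"
  have K: "?K \<subseteq> I" "card ?K = k" using D x y z ne fin_sub[of D] by auto
  have e: "\<exists>w\<in>W. \<forall>i\<in>?K. w i = (if i = j then 1 else 0)" for j
    using unit_word[OF K] by blast
  obtain wx where "wx \<in> W" "\<forall>i\<in>?K. wx i = (if i = x then 1 else 0)" using e by blast
  then have wx: "wx \<in> W" "wx x = 1" "wx y = 0" "wx z = 0" "\<forall>i\<in>D. wx i = 0"
    using x ne by auto
  obtain wy where "wy \<in> W" "\<forall>i\<in>?K. wy i = (if i = y then 1 else 0)" using e by blast
  then have wy: "wy \<in> W" "wy x = 0" "wy y = 1" "wy z = 0" "\<forall>i\<in>D. wy i = 0"
    using y ne by auto
  obtain wz where "wz \<in> W" "\<forall>i\<in>?K. wz i = (if i = z then 1 else 0)" using e by blast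
  then have wz: "wz \<in> W" "wz x = 0" "wz y = 0" "wz z = 1" "\<forall>i\<in>D. wz i = 0"
    using z ne by auto
  \<comment> \<open>In the cyclic identity for \<open>b\<close>, \<open>c\<close>, \<open>u\<close>
    the term with \<open>w b\<close> drops out.\<close>
  have rel: "d' b u = w u * d' b c"
    if "alternating_at (insert a D) d'" "w \<in> W" "\<forall>i\<in>D. w i = 0" "w a = 0" "w b = 0" "w c = 1"
      "b \<in> I" "c \<in> I" for a b c w d'
  proof -
    have "w b * d' c u + w c * d' u b + w u * d' b c = 0"
      by (rule alternating_at_cyclic[OF that(1,2)]) (use that u in auto)
    then show ?thesis
      using that alternating_at_antisym[OF that(1), of u b] by simp
  qed
  have xyzI: "x \<in> I" "y \<in> I" "z \<in> I" using x y z by auto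
  \<comment> \<open>Both sides of the claim become
    \<open>wx u * wy u * wz u * d1 y z * d2 z x * d3 x y\<close>; the three antisymmetries supply
    the sign.\<close>
  have "d1 y u = wz u * d1 y z" by (rule rel[OF d(1) wz(1,5,2,3,4) xyzI(2,3)])
  moreover have "d1 z u = wy u * d1 z y" by (rule rel[OF d(1) wy(1,5,2,4,3) xyzI(3,2)])
  moreover have "d2 z u = wx u * d2 z x" by (rule rel[OF d(2) wx(1,5,3,4,2) xyzI(3,1)])
  moreover have "d2 x u = wz u * d2 x z" by (rule rel[OF d(2) wz(1,5,3,2,4) xyzI(1,3)])
  moreover have "d3 x u = wy u * d3 x y" by (rule rel[OF d(3) wy(1,5,4,2,3) xyzI(1,2)])
  moreover have "d3 y u = wx u * d3 y x" by (rule rel[OF d(3) wx(1,5,4,3,2) xyzI(2,1)])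
  moreover have "d1 z y = - d1 y z" "d2 x z = - d2 z x" "d3 y x = - d3 x y"
    by (rule alternating_at_antisym[OF d(1)] alternating_at_antisym[OF d(2)]
        alternating_at_antisym[OF d(3)])+
  ultimately show ?thesis by simp
qed

text \<open>Segre's lemma of tangents, in a form that serves for \<open>X = I\<close> and for
  \<open>X = E\<close>. Each \<open>u\<close> outside \<open>D\<close> and the triangle contributes
  a sign through \<open>alternating_at_triangle\<close>; the factors joining two of
  \<open>x\<close>, \<open>y\<close>, \<open>z\<close> contribute one more by antisymmetry.\<close>

lemma alternating_at_triangle_prod:
  assumes D: "D \<subseteq> I" "Suc (Suc (Suc (card D))) = k"
    and x: "x \<in> I - D" and y: "y \<in> I - D" and z: "z \<in> I - D"
    and ne: "x \<noteq> y" "y \<noteq> z" "x \<noteq> z"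
    and d: "alternating_at (insert x D) d1" "alternating_at (insert y D) d2" "alternating_at (insert z D) d3"
    and X: "X \<subseteq> I" "x \<in> X" "y \<in> X" "z \<in> X"
  shows "(\<Prod>u\<in>X - insert x D - {y}. d1 y u) * (\<Prod>u\<in>X - insert y D - {z}. d2 z u) *
      (\<Prod>u\<in>X - insert z D - {x}. d3 x u) =
    (- 1) ^ Suc (card (X - insert x (insert y (insert z D)))) *
    ((\<Prod>u\<in>X - insert x D - {z}. d1 z u) * (\<Prod>u\<in>X - insert y D - {x}. d2 x u) *
      (\<Prod>u\<in>X - insert z D - {y}. d3 y u))"
proof -
  define U where "U = X - insert x (insert y (insert z D))"
  have finU: "finite U" using fin_sub X(1) by (auto simp: U_def)
  have nU: "x \<notin> U" "y \<notin> U" "z \<notin> U" by (auto simp: U_def)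
  have sets: "X - insert x D - {y} = insert z U" "X - insert y D - {z} = insert x U"
    "X - insert z D - {x} = insert y U" "X - insert x D - {z} = insert y U"
    "X - insert y D - {x} = insert z U" "X - insert z D - {y} = insert x U"
    using x y z ne X by (auto simp: U_def)
  have anti: "d1 z y = - d1 y z" "d2 x z = - d2 z x" "d3 y x = - d3 x y"
    by (rule alternating_at_antisym[OF d(1)] alternating_at_antisym[OF d(2)]
        alternating_at_antisym[OF d(3)])+
  have "(\<Prod>u\<in>U. d1 y u) * (\<Prod>u\<in>U. d2 z u) * (\<Prod>u\<in>U. d3 x u) =
      (\<Prod>u\<in>U. d1 y u * d2 z u * d3 x u)"
    by (simp add: prod.distrib)
  also have "\<dots> = (\<Prod>u\<in>U. - 1 * (d1 z u * d2 x u * d3 y u))"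
  proof (intro prod.cong refl)
    fix u assume "u \<in> U"
    then have "u \<in> I" using X by (auto simp: U_def)
    then show "d1 y u * d2 z u * d3 x u = - 1 * (d1 z u * d2 x u * d3 y u)"
      using alternating_at_triangle[OF D x y z ne _ d, of u] by simp
  qed
  also have "\<dots> = (- 1) ^ card U * ((\<Prod>u\<in>U. d1 z u) * (\<Prod>u\<in>U. d2 x u) * (\<Prod>u\<in>U. d3 y u))"
    by (simp only: prod.distrib prod_constant)
  finally have prodU: "(\<Prod>u\<in>U. d1 y u) * (\<Prod>u\<in>U. d2 z u) * (\<Prod>u\<in>U. d3 x u) =
    (- 1) ^ card U * ((\<Prod>u\<in>U. d1 z u) * (\<Prod>u\<in>U. d2 x u) * (\<Prod>u\<in>U. d3 y u))" .
  have "(\<Prod>u\<in>insert z U. d1 y u) * (\<Prod>u\<in>insert x U. d2 z u) * (\<Prod>u\<in>insert y U. d3 x u) =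
      d1 y z * d2 z x * d3 x y * ((\<Prod>u\<in>U. d1 y u) * (\<Prod>u\<in>U. d2 z u) * (\<Prod>u\<in>U. d3 x u))"
    using finU nU by (simp add: mult_ac)
  also have "\<dots> = (- 1) ^ Suc (card U) *
      (d1 z y * d2 x z * d3 y x * ((\<Prod>u\<in>U. d1 z u) * (\<Prod>u\<in>U. d2 x u) * (\<Prod>u\<in>U. d3 y u)))"
    unfolding prodU anti by (simp add: mult_ac)
  also have "\<dots> = (- 1) ^ Suc (card U) *
      ((\<Prod>u\<in>insert y U. d1 z u) * (\<Prod>u\<in>insert z U. d2 x u) * (\<Prod>u\<in>insert x U. d3 y u))"
    using finU nU by (simp add: mult_ac)
  finally show ?thesis unfolding sets U_def[symmetric] .
qed

end

section \<open>Bounds on the length of MDS codes over a finite field\<close>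

text \<open>The coordinates are distinct points of a projective line: with \<open>a\<close> at
  infinity, \<open>v x / w x\<close> is an injective affine coordinate on the others.\<close>

lemma mds_code_2_card_le:
  fixes W :: "('i \<Rightarrow> 'f :: {field, finite}) set"
  assumes "mds_code W I 2"
  shows "card I \<le> CARD('f) + 1"
proof -
  interpret mds_code W I 2 by (rule assms)
  obtain B where "B \<subseteq> I" "card B = 2" using k_le by (rule obtain_subset_with_card_n)
  then obtain a b where ab: "a \<in> I" "b \<in> I" "a \<noteq> b" unfolding card_2_iff by auto
  have pair: "{x, y} \<subseteq> I \<and> card {x, y} = 2" if "x \<in> I" "y \<in> I" "x \<noteq> y" for x y
    using that by simp
  obtain v where "v \<in> W" "\<forall>i\<in>{a, b}. v i = (if i = a then 1 else 0)"
    using unit_word pair[OF ab] by meson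
  then have v: "v \<in> W" "v a = 1" by auto
  obtain w where "w \<in> W" "\<forall>i\<in>{a, b}. w i = (if i = b then 1 else 0)"
    using unit_word pair[OF ab] by meson
  then have w: "w \<in> W" "w a = 0" "w b = 1" using ab by auto
  have w0: "w x \<noteq> 0" if "x \<in> I - {a}" for x
  proof
    assume "w x = 0"
    then have "w i = 0" if "i \<in> {a, x}" for i
      using that w(2) by blast
    then have "w b = 0"
      using vanish[OF w(1), of "{a, x}" b] pair[of a x] that ab by blast
    then show False using w by simp
  qed
  have "inj_on (\<lambda>x. v x / w x) (I - {a})"
  proof (rule inj_onI, rule ccontr)
    fix x y assume xy: "x \<in> I - {a}" "y \<in> I - {a}" "v x / w x = v y / w y" "x \<noteq> y"
    let ?s = "v x / w x"
    \<comment> \<open>If two ratios agree, \<open>v - ?s * w\<close> vanishes at two coordinates and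
      hence at \<open>a\<close>, where its value is 1.\<close>
    have "1 * v x + - ?s * w x = 0" using w0[OF xy(1)] by simp
    moreover have "1 * v y + - ?s * w y = 0" unfolding xy(3) using w0[OF xy(2)] by simp
    ultimately have "1 * v i + - ?s * w i = 0" if "i \<in> {x, y}" for i
      using that by blast
    then have "1 * v a + - ?s * w a = 0"
      using vanish[OF lin[OF v(1) w(1)], of "{x, y}" 1 "- ?s" a] pair[of x y] xy(1,2,4) ab by blast
    then show False using v w by simp
  qed
  then have "card (I - {a}) \<le> CARD('f)" by (rule card_inj_on_le) auto
  then show ?thesis using ab fin by simp
qed

text \<open>The length \<open>CARD('f) + 2\<close> enters twice: it makes the sign in the triangle
  identity for \<open>g\<close> trivial, and it meets the cardinality condition of
  \<open>sum_inverse_prod_alternating\<close>.\<close>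

lemma mds_code_no_excess:
  fixes W :: "('i \<Rightarrow> 'f :: {field, finite}) set"
  assumes "mds_code W I (Suc (Suc r))" and r: "r \<ge> 1"
    and card: "card I = CARD('f) + 2" and size: "2 * r + 1 \<le> card I"
    and char: "\<And>j. 0 < j \<Longrightarrow> j \<le> Suc r \<Longrightarrow> of_nat j \<noteq> (0 :: 'f)"
  shows False
proof -
  interpret mds_code W I "Suc (Suc r)" by (rule assms)
  obtain E where E: "E \<subseteq> I" "card E = 2 * r + 1"
    using size by (rule obtain_subset_with_card_n)
  have finE: "finite E" using E fin_sub by blast
  have finY: "finite Y" if "Y \<subseteq> E" for Y using finE that by (rule rev_finite_subset)
  have "\<forall>Y. \<exists>d. Y \<subseteq> I \<and> card Y = r \<longrightarrow> alternating_at Y d"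
    using ex_alternating_at by blast
  then obtain d where d: "\<And>Y. Y \<subseteq> I \<Longrightarrow> card Y = r \<Longrightarrow> alternating_at Y (d Y)"
    by metis
  define g where "g Y a = 1 / ((\<Prod>u\<in>I - Y - {a}. d Y a u) * (\<Prod>z\<in>E - Y - {a}. d Y a z))" for Y a
  have g0: "g Y a \<noteq> 0" if "Y \<subseteq> E" "card Y = r" "a \<in> E - Y" for Y a
  proof -
    have "alternating_at Y (d Y)" using that E by (intro d) auto
    then have "d Y a u \<noteq> 0" if "u \<in> I - Y - {a}" for u
      by (rule alternating_at_nonzero) (use that \<open>a \<in> E - Y\<close> E in auto)
    then show ?thesis using fin finE E by (auto simp: g_def)
  qed
  have triangle: "g (insert x D) y * g (insert y D) z * g (insert z D) x =
           g (insert x D) z * g (insert y D) x * g (insert z D) y"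
    if D: "D \<subseteq> E" "Suc (card D) = r" and xyz: "x \<in> E - D" "y \<in> E - D" "z \<in> E - D"
      and ne: "x \<noteq> y" "y \<noteq> z" "x \<noteq> z" for D x y z
  proof -
    have DI: "D \<subseteq> I" "Suc (Suc (Suc (card D))) = Suc (Suc r)" using D E by auto
    have xyzI: "x \<in> I - D" "y \<in> I - D" "z \<in> I - D" using xyz E by auto
    have cD: "card (insert x D) = r" "card (insert y D) = r" "card (insert z D) = r"
      using D xyz finY[of D] by auto
    have alt: "alternating_at (insert x D) (d (insert x D))"
      "alternating_at (insert y D) (d (insert y D))" "alternating_at (insert z D) (d (insert z D))"
      using DI(1) xyzI cD by (auto intro!: d)
    note tp = alternating_at_triangle_prod[OF DI xyzI ne alt]
    define m n where "m = card (I - insert x (insert y (insert z D)))"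
      and "n = card (E - insert x (insert y (insert z D)))"
    have c3: "card (insert x (insert y (insert z D))) = Suc (Suc r)"
      using D xyz ne finY[of D] by auto
    have "m = card I - Suc (Suc r)" unfolding m_def
      using c3 DI(1) xyzI fin_sub by (subst card_Diff_subset) auto
    moreover have "n = card E - Suc (Suc r)" unfolding n_def
      using c3 D(1) xyz finY by (subst card_Diff_subset) auto
    moreover have "Suc (Suc r) \<le> card E"
      using c3 card_mono[OF finE, of "insert x (insert y (insert z D))"] D xyz by auto
    \<comment> \<open>The signs for \<open>X = I\<close> and \<open>X = E\<close> combine to
      exponent \<open>CARD('f) + 1\<close>, and \<open>(- 1) ^ (CARD('f) - 1) = 1\<close> holds in
      every characteristic by Fermat.\<close>
    ultimately have "Suc m + Suc n = CARD('f) - 1 + 2" using card E size by linarith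
    then have "(- 1 :: 'f) ^ (Suc m + Suc n) = (- 1) ^ (CARD('f) - 1) * (- 1) ^ 2"
      by (simp only: power_add)
    then have sign: "(- 1 :: 'f) ^ Suc m * (- 1) ^ Suc n = 1"
      using finite_field_fermat[of "- 1 :: 'f"] by (simp only: power_add) simp
    have "s * P' * (t * Q') = P' * Q'" if "s * t = 1" for s t P' Q' :: 'f
    proof -
      have "s * P' * (t * Q') = s * t * (P' * Q')" by (simp only: mult_ac)
      then show ?thesis using that by simp
    qed
    note cancel = this[OF sign]
    have mI: "x \<in> I" "y \<in> I" "z \<in> I" "x \<in> E" "y \<in> E" "z \<in> E" using xyz xyzI by auto
    have "(1 / (a * a')) * (1 / (b * b')) * (1 / (c * c')) = 1 / (a * b * c * (a' * b' * c'))"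
      for a b c a' b' c' :: 'f by (simp add: mult_ac)
    then show ?thesis
      unfolding g_def
      by (simp only: tp[OF order.refl mI(1-3)] tp[OF E(1) mI(4-6)] m_def[symmetric] n_def[symmetric] cancel)
  qed
  have "\<exists>l. (\<forall>Y. l Y \<noteq> 0) \<and>
    (\<forall>D x y. D \<subseteq> E \<longrightarrow> Suc (card D) = r \<longrightarrow> x \<in> E - D \<longrightarrow> y \<in> E - D \<longrightarrow> x \<noteq> y \<longrightarrow>
       l (insert x D) * g (insert x D) y = l (insert y D) * g (insert y D) x)"
    by (rule cocycle_trivial[OF finE]) (fact g0, fact triangle)
  then obtain l where l0: "\<And>Y. l Y \<noteq> 0" and l: "\<And>D x y. D \<subseteq> E \<Longrightarrow> Suc (card D) = r \<Longrightarrow>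
      x \<in> E - D \<Longrightarrow> y \<in> E - D \<Longrightarrow> x \<noteq> y \<Longrightarrow>
      l (insert x D) * g (insert x D) y = l (insert y D) * g (insert y D) x"
    by blast
  \<comment> \<open>The chosen element is immaterial: by the relation for \<open>l\<close>, the
    product \<open>l Y * g Y a\<close> depends only on \<open>insert a Y\<close>.\<close>
  define v where "v C = (let x = SOME x. x \<in> C in l (C - {x}) * g (C - {x}) x)" for C
  have v: "v (insert a Y) = l Y * g Y a" if Y: "Y \<subseteq> E" "card Y = r" "a \<in> E - Y" for Y a
  proof -
    define x where "x = (SOME x. x \<in> insert a Y)"
    have x: "x \<in> insert a Y" unfolding x_def by (rule someI[of _ a]) simp
    have vx: "v (insert a Y) = l (insert a Y - {x}) * g (insert a Y - {x}) x"
      by (simp add: v_def x_def Let_def)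
    show ?thesis
    proof (cases "x = a")
      case True
      then have "insert a Y - {x} = Y" using Y by auto
      then show ?thesis using vx True by simp
    next
      case False
      define D where "D = Y - {x}"
      have D: "D \<subseteq> E" "Suc (card D) = r" "x \<in> E - D" "a \<in> E - D" "Y = insert x D"
        "insert a Y - {x} = insert a D"
        using x False Y finY[OF Y(1)] card_gt_0_iff[of Y] r by (auto simp: D_def)
      then show ?thesis using vx l[OF D(1-4) False] by simp
    qed
  qed
  have local: "(\<Sum>a\<in>E - Y. v (insert a Y)) = 0" if Y: "Y \<subseteq> E" "card Y = r" for Y
  proof -
    have alt: "alternating_at Y (d Y)" using Y E by (intro d) auto
    then have "\<exists>f h. \<forall>a b. d Y a b = f a * h b - h a * f b"
      unfolding alternating_at_def by (rule conjunct1)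
    then obtain f h where "\<forall>a b. d Y a b = f a * h b - h a * f b" by (elim exE)
    then have fh: "d Y a b = f a * h b - h a * f b" for a b by simp
    have "(\<Sum>a\<in>E - Y. g Y a) = 0"
      unfolding g_def fh
    proof (rule sum_inverse_prod_alternating)
      show "finite (I - Y)" "E - Y \<subseteq> I - Y" using fin E by auto
      have "card (E - Y) = r + 1" "card (I - Y) = CARD('f) + 2 - r" "r \<le> CARD('f) + 2"
        using Y E card size finY[of Y] by (auto simp: card_Diff_subset)
      then show "card (E - Y) + card (I - Y) = CARD('f) + 3" "2 \<le> card (E - Y)"
        using r by auto
      show "f a * h b - h a * f b \<noteq> 0" if "a \<in> I - Y" "b \<in> I - Y" "a \<noteq> b" for a b
        using alternating_at_nonzero[OF alt that] by (simp add: fh)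
    qed
    then have "(\<Sum>a\<in>E - Y. l Y * g Y a) = 0" by (simp flip: sum_distrib_left)
    then show ?thesis using v[OF Y] by simp
  qed
  have "Suc r \<le> card E" using E by simp
  then obtain C where C: "C \<subseteq> E" "card C = Suc r" by (rule obtain_subset_with_card_n)
  then obtain a where a: "a \<in> C" by fastforce
  have "v C = 0" by (rule inclusion_matrix_kernel_trivial[OF finE E(2) local char C])
  moreover have "v C \<noteq> 0"
  proof -
    have Y: "C - {a} \<subseteq> E" "card (C - {a}) = r" "a \<in> E - (C - {a})"
      using C a finY[of C] by auto
    have "insert a (C - {a}) = C" using a by auto
    then show ?thesis using v[OF Y] l0 g0[OF Y] by simp
  qed
  ultimately show False by simp
qed

text \<open>\<open>mds_code_no_excess\<close> needs \<open>2 * r + 1\<close> coordinates, that is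
  \<open>2 * m \<le> CARD('f) + 5\<close> for dimension \<open>m = r + 2\<close>. When
  \<open>k\<close> is too large for this, the dual code has a smaller dimension within the bound,
  and \<open>char\<close> still covers it.\<close>

lemma mds_code_card_ne:
  fixes W :: "('i \<Rightarrow> 'f :: {field, finite}) set"
  assumes W: "mds_code W I k" and k: "2 \<le> k" "k \<le> CARD('f)"
    and char: "\<And>j. 0 < j \<Longrightarrow> j < k \<Longrightarrow> of_nat j \<noteq> (0 :: 'f)"
  shows "card I \<noteq> CARD('f) + 2"
proof
  assume card: "card I = CARD('f) + 2"
  have small: False
    if W: "mds_code V I m" and m: "2 \<le> m" "m \<le> k" "2 * m \<le> CARD('f) + 5" for V :: "('i \<Rightarrow> 'f) set" and m
  proof (cases "m = 2")
    case True
    then show False using mds_code_2_card_le[of V I] W card by simp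
  next
    case False
    define r where "r = m - 2"
    have r: "m = Suc (Suc r)" "r \<ge> 1" using False m by (auto simp: r_def)
    show False
      by (rule mds_code_no_excess[of V I r]) (use W r card m char in auto)
  qed
  show False
  proof (cases "2 * k \<le> CARD('f) + 5")
    case True
    then show False using small[OF W] k by simp
  next
    case False
    then have "2 \<le> card I - k" "card I - k \<le> k" "2 * (card I - k) \<le> CARD('f) + 5"
      using k card by auto
    then show False using small[OF mds_code.dual[OF W]] by blast
  qed
qed

subsection \<open>Vectors in general position\<close>

lemma scalar_prod_eq_0_of_basis:
  fixes K :: "'a :: field vec set"
  assumes K: "vectorspace.basis class_ring (module_vec TYPE('a) k) K" "finite K"
    and c: "c \<in> carrier_vec k" "\<And>x. x \<in> K \<Longrightarrow> c \<bullet> x = 0" and y: "y \<in> carrier_vec k"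
  shows "c \<bullet> y = 0"
proof -
  interpret vec_space "TYPE('a)" k .
  have Kc: "K \<subseteq> carrier_vec k" and "span K = carrier_vec k"
    using K(1) by (simp_all add: basis_def)
  then have "y \<in> span K" using y by simp
  then obtain a where "y = lincomb a K"
    using finite_span[OF K(2)] Kc by auto
  then have "y \<bullet> c = (\<Sum>x\<in>K. (a x \<cdot>\<^sub>v x) \<bullet> c)"
    using finsum_scalar_prod_sum[of "\<lambda>x. a x \<cdot>\<^sub>v x" K c] Kc c(1) by (auto simp: lincomb_def)
  also have "\<dots> = 0"
  proof (intro sum.neutral ballI)
    fix x assume x: "x \<in> K"
    then have "x \<in> carrier_vec k" using Kc by blast
    then show "(a x \<cdot>\<^sub>v x) \<bullet> c = 0"
      using c(1) c(2)[OF x] comm_scalar_prod[of c k x] by simp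
  qed
  finally show ?thesis using comm_scalar_prod[OF c(1) y] by simp
qed

text \<open>Counting: evaluation on \<open>K\<close> is injective from coefficient vectors to
  functions on \<open>K\<close>, and both sets have \<open>CARD('a) ^ k\<close> elements, so it is
  onto.\<close>

lemma ex_scalar_prod_eq_on_basis:
  fixes K :: "'a :: {field, finite} vec set"
  assumes K: "vectorspace.basis class_ring (module_vec TYPE('a) k) K" "finite K" "card K = k"
    and Kc: "K \<subseteq> carrier_vec k"
  shows "\<exists>c\<in>carrier_vec k. \<forall>x\<in>K. c \<bullet> x = h x"
proof -
  define \<Phi> where "\<Phi> f = restrict (\<lambda>x. vec k f \<bullet> x) K" for f
  let ?A = "{..<k} \<rightarrow>\<^sub>E (UNIV :: 'a set)" and ?B = "K \<rightarrow>\<^sub>E (UNIV :: 'a set)"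
  have "inj_on \<Phi> ?A"
  proof (rule inj_onI)
    fix f f' assume f: "f \<in> ?A" "f' \<in> ?A" and eq: "\<Phi> f = \<Phi> f'"
    have zero: "(vec k f - vec k f') \<bullet> x = 0" if x: "x \<in> K" for x
    proof -
      have "x \<in> carrier_vec k" using x Kc by blast
      then have "(vec k f - vec k f') \<bullet> x = vec k f \<bullet> x - vec k f' \<bullet> x"
        by (intro minus_scalar_prod_distrib[of _ k]) auto
      moreover have "\<Phi> f x = \<Phi> f' x" using eq by simp
      ultimately show ?thesis using x by (simp add: \<Phi>_def)
    qed
    have orth: "(vec k f - vec k f') \<bullet> y = 0" if "y \<in> carrier_vec k" for y
      by (rule scalar_prod_eq_0_of_basis[OF K(1,2) _ zero that]) auto
    have "f i = f' i" if "i < k" for i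
    proof -
      have "(vec k f - vec k f') $ i = (vec k f - vec k f') \<bullet> unit_vec k i"
        using that by (intro scalar_prod_right_unit[symmetric]) auto
      then show ?thesis using that orth[of "unit_vec k i"] by simp
    qed
    then show "f = f'" by (rule PiE_ext[OF f]) simp
  qed
  then have "card (\<Phi> ` ?A) = card ?A" by (rule card_image)
  then have "card (\<Phi> ` ?A) = card ?B" using K by (simp add: card_PiE)
  moreover have "finite ?B" using K(2) by (rule finite_PiE) simp
  moreover have "\<Phi> ` ?A \<subseteq> ?B"
    unfolding \<Phi>_def by (intro image_subsetI restrict_PiE_iff[THEN iffD2] ballI UNIV_I)
  ultimately have "\<Phi> ` ?A = ?B" by (intro card_subset_eq)
  moreover have "restrict h K \<in> ?B" by (intro restrict_PiE_iff[THEN iffD2] ballI UNIV_I)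
  ultimately have "restrict h K \<in> \<Phi> ` ?A" by simp
  then obtain f where "restrict h K = \<Phi> f" by (rule imageE)
  then have f: "restrict h K x = \<Phi> f x" for x by (rule fun_cong)
  have "vec k f \<bullet> x = h x" if "x \<in> K" for x
    using f[of x] that by (simp add: \<Phi>_def)
  then show ?thesis by (intro bexI[of _ "vec k f"]) auto
qed

text \<open>Codewords are linear functionals evaluated on \<open>S\<close>; a functional can be
  prescribed on a basis and is determined by its values there.\<close>

lemma mds_code_of_vectors:
  fixes S :: "'a :: {field, finite} vec set"
  assumes S: "S \<subseteq> carrier_vec k" "finite S" "k \<le> card S"
    and basis: "\<And>B. B \<subseteq> S \<Longrightarrow> card B = k \<Longrightarrow>
          vectorspace.basis class_ring (module_vec TYPE('a) k) B"
  shows "mds_code {w. \<exists>c\<in>carrier_vec k. \<forall>x\<in>S. w x = c \<bullet> x} S k"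
proof
  let ?W = "{w. \<exists>c\<in>carrier_vec k. \<forall>x\<in>S. w x = c \<bullet> x}"
  show "finite S" "k \<le> card S" using S by auto
  show "(\<lambda>x. a * v x + b * w x) \<in> ?W" if "v \<in> ?W" "w \<in> ?W" for v w a b
  proof -
    obtain c c' where c: "c \<in> carrier_vec k" "\<forall>x\<in>S. v x = c \<bullet> x"
      "c' \<in> carrier_vec k" "\<forall>x\<in>S. w x = c' \<bullet> x"
      using \<open>v \<in> ?W\<close> \<open>w \<in> ?W\<close> by blast
    have "a * v x + b * w x = (a \<cdot>\<^sub>v c + b \<cdot>\<^sub>v c') \<bullet> x" if "x \<in> S" for x
    proof -
      have "x \<in> carrier_vec k" using that S by blast
      then show ?thesis
        using c that by (simp add: add_scalar_prod_distrib[of _ k])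
    qed
    then show ?thesis using c by (auto intro!: bexI[of _ "a \<cdot>\<^sub>v c + b \<cdot>\<^sub>v c'"])
  qed
  have finK: "finite K" if "K \<subseteq> S" for K using S(2) that by (rule rev_finite_subset)
  show "\<exists>w\<in>?W. \<forall>x\<in>K. w x = h x" if K: "K \<subseteq> S" "card K = k" for K h
  proof -
    obtain c where "c \<in> carrier_vec k" "\<forall>x\<in>K. c \<bullet> x = h x"
      using ex_scalar_prod_eq_on_basis[OF basis[OF K] finK[OF K(1)] K(2)] K S by blast
    then show ?thesis by (intro bexI[of _ "\<lambda>x. c \<bullet> x"]) auto
  qed
  show "w y = 0" if w: "w \<in> ?W" and K: "K \<subseteq> S" "card K = k"
    and w0: "\<And>x. x \<in> K \<Longrightarrow> w x = 0" and y: "y \<in> S" for w K y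
  proof -
    obtain c where c: "c \<in> carrier_vec k" "\<forall>x\<in>S. w x = c \<bullet> x" using w by blast
    have "c \<bullet> x = 0" if "x \<in> K" for x using w0[OF that] c K that by auto
    then have "c \<bullet> y = 0"
      using scalar_prod_eq_0_of_basis[OF basis[OF K] finK[OF K(1)] c(1)] y S by blast
    then show ?thesis using c y by simp
  qed
qed

lemma CHAR_eq_of_CARD_prime_power:
  assumes "prime p" "CARD('a :: {field, finite}) = p ^ h"
  shows "CHAR('a) = p"
proof -
  have "CHAR('a) dvd p ^ h" using CHAR_dvd_CARD[where 'a = 'a] assms(2) by simp
  moreover have "prime CHAR('a)" by (rule prime_CHAR_semidom) (simp add: finite_imp_CHAR_pos)
  ultimately show ?thesis using assms(1) prime_dvd_power primes_dvd_imp_eq by blast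
qed

theorem theorem3p2:
  fixes p h q k :: nat
    and S :: "'a :: {field, finite} vec set"
  assumes "prime p"
    and "h \<ge> 1"
    and "q = p ^ h"
    and "CARD('a) = q"
    and "k \<ge> 1"
    and "S \<subseteq> carrier_vec k"
    and "\<And>B. B \<subseteq> S \<Longrightarrow> card B = k \<Longrightarrow>
          vectorspace.basis class_ring (module_vec TYPE('a) k) B"
    and "k \<le> p"
  shows "card S \<le> q + 1"
proof (cases "k = 1")
  case True
  \<comment> \<open>The code argument requires \<open>k \<ge> 2\<close>; for \<open>k = 1\<close> a
    vector is just its single entry.\<close>
  have "inj_on (\<lambda>x. x $ 0) S"
  proof (rule inj_onI)
    fix x y assume "x \<in> S" "y \<in> S" "x $ 0 = y $ 0"
    moreover from this have "x \<in> carrier_vec 1" "y \<in> carrier_vec 1" using assms(6) True by auto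
    ultimately show "x = y" by (intro eq_vecI) auto
  qed
  then have "card S \<le> CARD('a)" by (rule card_inj_on_le) auto
  then show ?thesis using assms(4) by simp
next
  case False
  show ?thesis
  proof (rule ccontr)
    assume "\<not> card S \<le> q + 1"
    then have "q + 2 \<le> card S" by simp
    \<comment> \<open>Every subset of \<open>S\<close> inherits the hypothesis, so it suffices to
      exclude length exactly \<open>q + 2\<close>.\<close>
    then obtain T where T: "T \<subseteq> S" "card T = q + 2" "finite T"
      by (rule obtain_subset_with_card_n)
    have "p ^ 1 \<le> q" unfolding assms(3)
      using assms(1,2) prime_ge_1_nat by (intro power_increasing) auto
    then have kq: "k \<le> q" using assms(8) by simp
    have "mds_code {w. \<exists>c\<in>carrier_vec k. \<forall>x\<in>T. w x = c \<bullet> x} T k"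
      using T assms(6) kq by (intro mds_code_of_vectors assms(7)) auto
    moreover have "of_nat j \<noteq> (0 :: 'a)" if "0 < j" "j < k" for j
      using that assms(8) CHAR_eq_of_CARD_prime_power[where 'a = 'a, of p h] assms(1,3,4)
      by (auto simp: of_nat_eq_0_iff_char_dvd dest: dvd_imp_le)
    ultimately have "card T \<noteq> CARD('a) + 2"
      using False assms(4,5) kq by (intro mds_code_card_ne) auto
    then show False using T assms(4) by simp
  qed
qed

unused_thms

end
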